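(* Let $\lambda$ be a nonzero real (or complex) number and let $k\ge 2$ be an integer. Then, as power series in $x$, $$\sum_{n=0}^{\infty}\beta_{n,\lambda}^{(k)}\frac{x^{n}}{n!}=\frac{1}{1-e_{\lambda}(-x)}\int_{0}^{x}\underbrace{\frac{e_{\lambda}^{1-\lambda}(-t)}{1-e_{\lambda}(-t)}\int_{0}^{t}\frac{e_{\lambda}^{1-\lambda}(-t)}{1-e_{\lambda}(-t)}\cdots\int_{0}^{t}}_{(k-2)\text{ times}}\frac{e_{\lambda}^{1-\lambda}(-t)}{1-e_{\lambda}(-t)}\,t\,dt\,dt\cdots dt,$$ where the iterated integral (with $k-1$ integral signs in total) means $J_k(x)$, with $J_1(x)=x$ and, for $j\ge 2$, $$J_j(x)=\int_0^x \frac{e_{\lambda}^{1-\lambda}(-t)}{1-e_{\lambda}(-t)}\,J_{j-1}(t)\,dt .$$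
   Context: All identities are between formal power series (equivalently, convergent power series for small argument). For nonzero $\lambda$ and any $x$, the degenerate exponential is $e_\lambda^x(t)=(1+\lambda t)^{x/\lambda}=\sum_{n\ge0}\binom{x/\lambda}{n}\lambda^n t^n$ and $e_\lambda(t)=e_\lambda^1(t)$. For nonzero $\mu$, put $(1)_{0,\mu}=1$ and $(1)_{n,\mu}=(1-\mu)(1-2\mu)\cdots(1-(n-1)\mu)$ for $n\ge1$ (so $(1)_{1,\mu}=1$). For $k\in\mathbb{Z}$ the degenerate polylogarithm function is $l_{k,\lambda}(x)=\sum_{n=1}^{\infty}\frac{(-\lambda)^{n-1}(1)_{n,1/\lambda}}{(n-1)!\,n^{k}}x^{n}$, and the degenerate poly-Bernoulli numbers $\beta_{n,\lambda}^{(k)}$ are defined by $$\frac{l_{k,\lambda}(1-e_{\lambda}(-t))}{1-e_{\lambda}(-t)}=\sum_{n=0}^{\infty}\beta_{n,\lambda}^{(k)}\frac{t^{n}}{n!},$$ i.e. by substituting $x=1-e_\lambda(-t)$ (which has zero constant term) into the power series $l_{k,\lambda}(x)/x$. *)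

theory Defs
  imports "HOL-Computational_Algebra.Formal_Power_Series"
begin

text \<open>All identities are identities of formal power series over a field of characteristic \<open>0\<close>;
  the real and the complex numbers are instances.\<close>

definition degenerate_exp :: "'a::field_char_0 \<Rightarrow> 'a \<Rightarrow> 'a fps" where
  "degenerate_exp lam x = Abs_fps (\<lambda>n. ((x / lam) gchoose n) * lam ^ n)"

text \<open>The series \<open>e\<^sub>\<lambda>\<^sup>x(-t)\<close> in \<open>t\<close>.\<close>

definition degenerate_exp_neg :: "'a::field_char_0 \<Rightarrow> 'a \<Rightarrow> 'a fps" where
  "degenerate_exp_neg lam x = degenerate_exp lam x oo (- fps_X)"

text \<open>\<open>degenerate_fact n \<mu>\<close> is \<open>(1)\<^bsub>n,\<mu>\<^esub>\<close>; the product is empty for \<open>n \<le> 1\<close>.\<close>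

definition degenerate_fact :: "nat \<Rightarrow> 'a::field_char_0 \<Rightarrow> 'a" where
  "degenerate_fact n \<mu> = (\<Prod>i=1..<n. 1 - of_nat i * \<mu>)"

definition degenerate_polylog :: "int \<Rightarrow> 'a::field_char_0 \<Rightarrow> 'a fps" where
  "degenerate_polylog k lam = Abs_fps (\<lambda>n. if n = 0 then 0 else
     (- lam) ^ (n - 1) * degenerate_fact n (1 / lam) / (fact (n - 1) * of_nat n powi k))"

text \<open>The series \<open>l\<^bsub>k,\<lambda>\<^esub>(x) / x\<close> is formed first, and \<open>x = 1 - e\<^sub>\<lambda>(-t)\<close> is substituted
  afterwards.  Both steps are exact: the polylogarithm and the substituted series
  have zero constant term.\<close>

definition degenerate_poly_bernoulli :: "nat \<Rightarrow> int \<Rightarrow> 'a::field_char_0 \<Rightarrow> 'a" where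
  "degenerate_poly_bernoulli n k lam =
     fact n * fps_nth ((degenerate_polylog k lam / fps_X) oo (1 - degenerate_exp_neg lam 1)) n"

text \<open>The integrand \<open>e\<^sub>\<lambda>\<^bsup>1-\<lambda>\<^esup>(-t) / (1 - e\<^sub>\<lambda>(-t)) \<cdot> J\<^bsub>j-1\<^esub>(t)\<close> is a power series although its first
  factor alone has a simple pole at \<open>0\<close>.  Since division of formal power series discards
  negative powers, the product is formed before dividing; the lemma
  \<open>iterated_integral_integrand\<close> below shows that nothing is then discarded.
  The value at index \<open>0\<close> is irrelevant.\<close>

fun iterated_integral :: "'a::field_char_0 \<Rightarrow> nat \<Rightarrow> 'a fps" where
  "iterated_integral lam 0 = 0"
| "iterated_integral lam (Suc 0) = fps_X"
| "iterated_integral lam (Suc (Suc j)) =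
     fps_integral0 ((degenerate_exp_neg lam (1 - lam) * iterated_integral lam (Suc j))
                    / (1 - degenerate_exp_neg lam 1))"

lemma iterated_integral_nth_0: "fps_nth (iterated_integral lam j) 0 = 0"
  by (induction lam j rule: iterated_integral.induct) (simp_all add: fps_integral_def)

lemma degenerate_exp_neg_nth:
  "fps_nth (degenerate_exp_neg lam x) n = (- 1) ^ n * ((x / lam) gchoose n) * lam ^ n"
  by (simp add: degenerate_exp_neg_def degenerate_exp_def fps_compose_uminus')

lemma subdegree_one_minus_degenerate_exp_neg:
  assumes "lam \<noteq> 0"
  shows "subdegree (1 - degenerate_exp_neg lam 1) = 1"
  using assms by (intro subdegreeI) (simp_all add: degenerate_exp_neg_nth)

lemma degenerate_exp_neg_dvd_iff:
  assumes "lam \<noteq> 0"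
  shows "(1 - degenerate_exp_neg lam 1) dvd f \<longleftrightarrow> fps_nth f 0 = 0"
proof (cases "f = 0")
  case False
  have "1 - degenerate_exp_neg lam 1 \<noteq> 0"
    using subdegree_one_minus_degenerate_exp_neg[OF assms] by force
  with False show ?thesis
    using subdegree_one_minus_degenerate_exp_neg[OF assms]
    by (auto simp: fps_dvd_iff Suc_le_eq subdegree_eq_0_iff zero_less_iff_neq_zero)
qed simp

lemma iterated_integral_integrand:
  assumes "lam \<noteq> 0"
  shows "(1 - degenerate_exp_neg lam 1) * fps_deriv (iterated_integral lam (Suc (Suc j))) =
         degenerate_exp_neg lam (1 - lam) * iterated_integral lam (Suc j)"
proof -
  have "(1 - degenerate_exp_neg lam 1) dvd
          degenerate_exp_neg lam (1 - lam) * iterated_integral lam (Suc j)"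
    by (simp add: degenerate_exp_neg_dvd_iff[OF assms] iterated_integral_nth_0)
  then show ?thesis
    by (simp add: fps_deriv_fps_integral)
qed

text \<open>Likewise, dividing \<open>J\<^sub>j(x)\<close> by \<open>1 - e\<^sub>\<lambda>(-x)\<close> is exact.\<close>

lemma iterated_integral_divide_exact:
  assumes "lam \<noteq> 0"
  shows "(1 - degenerate_exp_neg lam 1) *
           (iterated_integral lam j / (1 - degenerate_exp_neg lam 1)) = iterated_integral lam j"
  by (simp add: degenerate_exp_neg_dvd_iff[OF assms] iterated_integral_nth_0)

end

theory Submission
  imports Defs
begin

text \<open>Write \<open>u = 1 - e\<^sub>\<lambda>(-t)\<close>, so that \<open>u' = e\<^sub>\<lambda>\<^bsup>1-\<lambda>\<^esup>(-t)\<close>.  Since \<open>x l'\<^bsub>k+1\<^esub>(x) = l\<^sub>k(x)\<close>, the chain rule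
  shows that \<open>l\<^sub>k(u(t))\<close> obeys the recursion defining \<open>J\<^sub>k\<close>.  The recursion starts with
  \<open>l\<^sub>1(u(t)) = t\<close>, because \<open>l\<^sub>1(x) = (1 - (1 - x)\<^sup>\<lambda>) / \<lambda>\<close> is the compositional inverse of \<open>u\<close>.\<close>

lemma degenerate_exp_neg_nth_0 [simp]: "fps_nth (degenerate_exp_neg lam x) 0 = 1"
  by (simp add: degenerate_exp_neg_nth)

text \<open>Coefficientwise this is the absorption identity for binomials. The case
  \<open>x = 1\<close> yields \<open>u'\<close>.\<close>

lemma fps_deriv_degenerate_exp_neg:
  assumes "lam \<noteq> 0"
  shows "fps_deriv (degenerate_exp_neg lam x) = - (fps_const x * degenerate_exp_neg lam (x - lam))"
proof (rule fps_ext)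
  fix n
  have "of_nat (Suc n) * ((x / lam) gchoose Suc n) = (x / lam) * ((x - lam) / lam gchoose n)"
    using gbinomial_absorption[of n "x / lam"] assms by (simp add: diff_divide_distrib)
  then show "fps_nth (fps_deriv (degenerate_exp_neg lam x)) n =
        fps_nth (- (fps_const x * degenerate_exp_neg lam (x - lam))) n"
    using assms by (simp add: degenerate_exp_neg_nth field_simps del: of_nat_Suc)
qed

text \<open>The series is that of \<open>(1 - lam * t)\<close> to the power \<open>x / lam\<close>,
  whose logarithmic derivative is \<open>- x / (1 - lam * t)\<close>.\<close>

lemma degenerate_exp_neg_ode:
  assumes "lam \<noteq> 0"
  shows "(1 - fps_const lam * fps_X) * fps_deriv (degenerate_exp_neg lam x) =
         - (fps_const x * degenerate_exp_neg lam x)"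
proof (rule fps_ext)
  fix n
  let ?a = "x / lam"
  have *: "of_nat (Suc n) * (?a gchoose Suc n) = (?a - of_nat n) * (?a gchoose n)"
    using gbinomial_mult_1[of ?a n] by (simp add: algebra_simps)
  have "(- 1) ^ n * lam ^ Suc n * (of_nat (Suc n) * (?a gchoose Suc n)) =
        (- 1) ^ n * lam ^ n * ((x - lam * of_nat n) * (?a gchoose n))"
    unfolding * using assms by (simp add: field_simps)
  then show "fps_nth ((1 - fps_const lam * fps_X) * fps_deriv (degenerate_exp_neg lam x)) n =
        fps_nth (- (fps_const x * degenerate_exp_neg lam x)) n"
    by (cases n) (simp_all add: degenerate_exp_neg_nth algebra_simps)
qed

lemma degenerate_polylog_nth_0 [simp]: "fps_nth (degenerate_polylog k lam) 0 = 0"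
  by (simp add: degenerate_polylog_def)

lemma fps_deriv_degenerate_polylog_Suc:
  "fps_X * fps_deriv (degenerate_polylog (k + 1) lam) = degenerate_polylog k lam"
proof (rule fps_ext)
  fix n
  show "fps_nth (fps_X * fps_deriv (degenerate_polylog (k + 1) lam)) n =
        fps_nth (degenerate_polylog k lam) n"
    by (cases n) (simp_all add: degenerate_polylog_def power_int_add field_simps del: of_nat_Suc)
qed

text \<open>The derivative of the polylogarithm of index 1 is the binomial series of
  \<open>(1 - x)\<close> to the power \<open>lam - 1\<close>, which satisfies this equation. The
  proof uses only the ratio of consecutive coefficients.\<close>

lemma degenerate_polylog_1_ode:
  assumes "lam \<noteq> 0"
  shows "(1 - fps_X) * fps_deriv (fps_deriv (degenerate_polylog 1 lam)) =
         fps_const (1 - lam) * fps_deriv (degenerate_polylog 1 lam)"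
proof (rule fps_ext)
  fix n
  let ?D = "fps_deriv (degenerate_polylog 1 lam)"
  \<comment> \<open>Differentiation contributes a factor \<open>Suc m\<close>, which cancels the
    denominator \<open>of_nat n powi 1\<close> at \<open>n = Suc m\<close>.\<close>
  have D: "fps_nth ?D m = (- lam) ^ m * degenerate_fact (Suc m) (1 / lam) / fact m" for m
    by (simp add: degenerate_polylog_def field_simps del: of_nat_Suc)
  have "degenerate_fact (Suc (Suc n)) (1 / lam) =
        degenerate_fact (Suc n) (1 / lam) * (1 - of_nat (Suc n) * (1 / lam))"
    by (simp add: degenerate_fact_def prod.atLeastLessThan_Suc)
  then have rec: "- lam * degenerate_fact (Suc (Suc n)) (1 / lam) =
      (of_nat (Suc n) - lam) * degenerate_fact (Suc n) (1 / lam)"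
    using assms by (simp add: field_simps)
  have "of_nat (Suc n) * fps_nth ?D (Suc n) =
      (- lam) ^ n * (- lam * degenerate_fact (Suc (Suc n)) (1 / lam)) / fact n"
    unfolding D by (simp del: of_nat_Suc)
  also have "\<dots> = (of_nat (Suc n) - lam) * fps_nth ?D n"
    unfolding rec D by (simp del: of_nat_Suc)
  finally show "fps_nth ((1 - fps_X) * fps_deriv ?D) n = fps_nth (fps_const (1 - lam) * ?D) n"
    by (cases n) (simp_all add: left_diff_distrib algebra_simps)
qed

text \<open>The composition has derivative \<open>G * F\<close>. The differential equations of both
  factors show that this product is constant, so no closed form of either series is
  required.\<close>

lemma degenerate_polylog_1_compose:
  assumes "lam \<noteq> 0"
  shows "degenerate_polylog 1 lam oo (1 - degenerate_exp_neg lam 1) = fps_X"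
proof -
  define E where "E = degenerate_exp_neg lam 1"
  define F where "F = degenerate_exp_neg lam (1 - lam)"
  define L where "L = degenerate_polylog 1 lam"
  define G where "G = fps_deriv L oo (1 - E)"
  have u0: "fps_nth (1 - E) 0 = 0"
    by (simp add: E_def)
  have E': "fps_deriv E = - F"
    using fps_deriv_degenerate_exp_neg[OF assms, of 1] by (simp add: E_def F_def)
  \<comment> \<open>Comparing the two expressions for \<open>E'\<close> gives this instance of the
    power law.\<close>
  have E: "E = (1 - fps_const lam * fps_X) * F"
    using degenerate_exp_neg_ode[OF assms, of 1] E' by (simp add: E_def)
  have F': "(1 - fps_const lam * fps_X) * fps_deriv F = - (fps_const (1 - lam) * F)"
    unfolding F_def by (rule degenerate_exp_neg_ode[OF assms])
  \<comment> \<open>Multiplying by \<open>F\<close> turns the factor \<open>1 - lam * t\<close> into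
    \<open>E\<close>, which is also what \<open>1 - fps_X\<close> becomes under the
    substitution.\<close>
  have EF': "E * fps_deriv F = - (fps_const (1 - lam) * F * F)"
    using arg_cong[OF F', of "\<lambda>f. f * F"] by (simp add: E mult_ac)
  have G': "fps_deriv G = (fps_deriv (fps_deriv L) oo (1 - E)) * F"
    using fps_compose_deriv[OF u0, of "fps_deriv L"] by (simp add: G_def E')
  have "E * (fps_deriv (fps_deriv L) oo (1 - E)) =
        ((1 - fps_X) * fps_deriv (fps_deriv L)) oo (1 - E)"
    using u0 by (simp add: fps_compose_mult_distrib fps_compose_sub_distrib)
  also have "\<dots> = fps_const (1 - lam) * G"
    using u0 degenerate_polylog_1_ode[OF assms]
    by (simp add: L_def G_def fps_compose_mult_distrib)
  finally have EG': "E * fps_deriv G = fps_const (1 - lam) * G * F"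
    by (simp add: G' mult.assoc[symmetric])
  have "E * fps_deriv (G * F) = E * fps_deriv G * F + G * (E * fps_deriv F)"
    by (simp add: algebra_simps)
  also have "\<dots> = 0"
    by (simp add: EG' EF' algebra_simps)
  \<comment> \<open>\<open>E\<close> can be cancelled since its constant term is 1.\<close>
  finally have "fps_deriv (G * F) = 0"
    by (auto simp: E_def dest: arg_cong[of _ _ "\<lambda>f. fps_nth f 0"])
  moreover have "fps_nth (G * F) 0 = 1"
    by (simp add: G_def F_def L_def degenerate_polylog_def degenerate_fact_def)
  ultimately have GF: "G * F = 1"
    by (metis fps_const_1_eq_1 fps_deriv_eq_0_iff)
  have "fps_deriv (L oo (1 - E)) = fps_deriv fps_X"
    using fps_compose_deriv[OF u0, of L] GF by (simp add: G_def E')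
  then have "L oo (1 - E) = fps_X"
    unfolding fps_deriv_eq_iff by (simp add: L_def)
  then show ?thesis
    by (simp add: L_def E_def)
qed

text \<open>Both sides have zero constant term, so it suffices to compare derivatives. These are
  compared after multiplication by \<open>u\<close>, because \<open>1 / u\<close> is not a power
  series.\<close>

lemma degenerate_polylog_compose:
  assumes "lam \<noteq> 0"
  shows "degenerate_polylog (int (Suc j)) lam oo (1 - degenerate_exp_neg lam 1) =
         iterated_integral lam (Suc j)"
proof (induction j)
  case 0
  then show ?case
    using degenerate_polylog_1_compose[OF assms] by simp
next
  case (Suc j)
  define u where "u = 1 - degenerate_exp_neg lam 1"
  define L where "L = degenerate_polylog (int (Suc (Suc j))) lam"
  have u0: "fps_nth u 0 = 0"
    by (simp add: u_def)
  have u_nz: "u \<noteq> 0"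
    using subdegree_one_minus_degenerate_exp_neg[OF assms] by (force simp: u_def)
  have u': "fps_deriv u = degenerate_exp_neg lam (1 - lam)"
    using fps_deriv_degenerate_exp_neg[OF assms, of 1] by (simp add: u_def)
  have "u * (fps_deriv L oo u) = (fps_X * fps_deriv L) oo u"
    using u0 by (simp add: fps_compose_mult_distrib)
  also have "\<dots> = iterated_integral lam (Suc j)"
    using Suc fps_deriv_degenerate_polylog_Suc[of "int (Suc j)" lam]
    by (simp add: L_def u_def add_ac)
  finally have "u * fps_deriv (L oo u) =
      degenerate_exp_neg lam (1 - lam) * iterated_integral lam (Suc j)"
    using fps_compose_deriv[OF u0, of L] by (simp add: u' mult.assoc[symmetric] mult.commute)
  also have "\<dots> = u * fps_deriv (iterated_integral lam (Suc (Suc j)))"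
    unfolding u_def by (rule iterated_integral_integrand[OF assms, symmetric])
  finally have "fps_deriv (L oo u) = fps_deriv (iterated_integral lam (Suc (Suc j)))"
    using u_nz by (simp del: iterated_integral.simps)
  then have "L oo u = iterated_integral lam (Suc (Suc j))"
    by (simp add: fps_deriv_eq_iff L_def iterated_integral_nth_0 del: iterated_integral.simps)
  then show ?case
    by (simp only: L_def u_def)
qed

theorem theorem3:
  fixes lam :: "'a::field_char_0" and k :: int
  assumes "lam \<noteq> 0" and "k \<ge> 2"
  shows "Abs_fps (\<lambda>n. degenerate_poly_bernoulli n k lam / fact n) =
         iterated_integral lam (nat k) / (1 - degenerate_exp_neg lam 1)"
proof -
  define u where "u = 1 - degenerate_exp_neg lam 1"
  define Q where "Q = degenerate_polylog k lam / fps_X"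
  have u0: "fps_nth u 0 = 0"
    by (simp add: u_def)
  have u_nz: "u \<noteq> 0"
    using subdegree_one_minus_degenerate_exp_neg[OF assms(1)] by (force simp: u_def)
  have k: "k = int (Suc (nat k - 1))" "nat k = Suc (nat k - 1)"
    using assms(2) by auto
  \<comment> \<open>Division by \<open>fps_X\<close> shifts the coefficients; the only one it drops
    is the constant term, which is 0 here.\<close>
  have Q: "degenerate_polylog k lam = Q * fps_X"
    unfolding Q_def by (rule fps_ext) (simp add: fps_X_mult_right_nth)
  have "iterated_integral lam (nat k) = degenerate_polylog k lam oo u"
    using degenerate_polylog_compose[OF assms(1), of "nat k - 1"] k by (simp add: u_def)
  also have "\<dots> = (Q oo u) * u"
    using u0 by (simp add: Q fps_compose_mult_distrib)
  finally have "iterated_integral lam (nat k) / u = Q oo u"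
    using u_nz by simp
  moreover have "Abs_fps (\<lambda>n. degenerate_poly_bernoulli n k lam / fact n) = Q oo u"
    by (rule fps_ext) (simp add: degenerate_poly_bernoulli_def Q_def u_def)
  ultimately show ?thesis
    by (simp add: u_def)
qed

end
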